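(* For every integer $k>1$, the coefficients of $q^n$ in the formal power series $$\frac{(-1)^k}{(q^2,q^3,q^4,q^5;q^7)_\infty}\sum_{n\ge k}(-1)^nq^{n(3n+1)/2}\left(1-q^{2n+1}\right)$$ are zero for all $0\le n<k(3k+1)/2$ and for $n=k(3k+1)/2+1$; for $n=k(3k+1)/2$ and for all $n\ge k(3k+1)/2+2$ the coefficients are positive.
   Context: Notation: $(a;q)_\infty=\prod_{j\ge 0}(1-aq^j)$ and $(a_1,\ldots,a_m;q)_\infty=\prod_{1\le j\le m}(a_j;q)_\infty$. *)

theory Defs
  imports "HOL-Analysis.Analysis"
begin

text \<open>
  The formal power series ring carries its usual topology, in which a sequence converges iff each
  of its coefficients is eventually constant.  Infinite products and sums of formal power series
  are taken in this topology, so the topology of the coefficient field plays no role.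
\<close>

definition qpochhammer_inf :: "'a :: {t2_space, comm_ring_1} \<Rightarrow> 'a \<Rightarrow> 'a" where
  "qpochhammer_inf a q = (\<Prod>j. 1 - a * q ^ j)"

definition qpochhammers_inf :: "'a :: {t2_space, comm_ring_1} list \<Rightarrow> 'a \<Rightarrow> 'a" where
  "qpochhammers_inf as q = (\<Prod>a\<leftarrow>as. qpochhammer_inf a q)"

text \<open>
  The indeterminate \<open>q\<close> is \<^const>\<open>fps_X\<close>.  The exponents \<open>n * (3 * n + 1) div 2\<close> are exact
  divisions since \<open>n * (3 * n + 1)\<close> is even.
\<close>

definition truncated_series :: "nat \<Rightarrow> real fps" where
  "truncated_series k =
     (-1) ^ k / qpochhammers_inf [fps_X ^ 2, fps_X ^ 3, fps_X ^ 4, fps_X ^ 5] (fps_X ^ 7) *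
     (\<Sum>\<^sub>\<infinity>n\<in>{k..}. (-1) ^ n * fps_X ^ (n * (3 * n + 1) div 2) * (1 - fps_X ^ (2 * n + 1)))"

text \<open>
  The product and the sum above do converge, so neither \<^const>\<open>prodinf\<close> nor \<^const>\<open>infsum\<close>
  takes its default value.
\<close>

lemma has_prod_qpochhammer_inf_fps:
  fixes m r :: nat
  assumes "m > 0" "r > 0"
  shows "(\<lambda>j. 1 - fps_X ^ m * (fps_X ^ r) ^ j :: real fps) has_prod
           qpochhammer_inf (fps_X ^ m) (fps_X ^ r)"
    and "fps_nth (qpochhammer_inf (fps_X ^ m) (fps_X ^ r) :: real fps) 0 = 1"
proof -
  let ?f = "\<lambda>j. 1 - fps_X ^ m * (fps_X ^ r) ^ j :: real fps"
  have f: "?f j = 1 - fps_X ^ (m + r * j)" for j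
    by (simp add: power_add power_mult)
  have nth0: "fps_nth (?f j) 0 = 1" for j
    using assms by (simp add: f)
  have "subdegree (?f k - 1) > n" if "k > n" for n k
  proof -
    have "n < r * k" using that assms(2) by (cases r) auto
    then show ?thesis by (simp add: f subdegree_power)
  qed
  moreover have "?f k \<noteq> 0" for k using nth0[of k] by fastforce
  ultimately obtain P where P: "(\<lambda>n. \<Prod>k\<le>n. ?f k) \<longlonglongrightarrow> P"
    using tendsto_prod_fps[of ?f "\<lambda>n. n"] by blast
  have "fps_nth (\<Prod>k\<le>n. ?f k) 0 = 1" for n
    by (induction n) (use nth0 assms in auto)
  then have P0: "fps_nth P 0 = 1"
    using P unfolding tendsto_fps_iff by (metis (mono_tags, lifting) eventually_sequentially order_refl)
  then have "P \<noteq> 0" by auto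
  with P have hp: "?f has_prod P" by (simp add: has_prod_def raw_has_prod_def)
  then have "P = qpochhammer_inf (fps_X ^ m) (fps_X ^ r)"
    unfolding qpochhammer_inf_def by (rule has_prod_unique)
  with hp P0 show "?f has_prod qpochhammer_inf (fps_X ^ m) (fps_X ^ r)"
    and "fps_nth (qpochhammer_inf (fps_X ^ m) (fps_X ^ r) :: real fps) 0 = 1" by auto
qed

lemma summable_on_truncated_series:
  "(\<lambda>n. (-1) ^ n * fps_X ^ (n * (3 * n + 1) div 2) * (1 - fps_X ^ (2 * n + 1)) :: real fps)
     summable_on {k..}"
proof -
  let ?f = "\<lambda>n. (-1) ^ n * fps_X ^ (n * (3 * n + 1) div 2) * (1 - fps_X ^ (2 * n + 1)) :: real fps"
  have z: "fps_nth (?f n) i = 0" if "n > i" for n i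
  proof -
    have "2 * n \<le> n * (3 * n + 1)" by (cases n) auto
    then have "i < n * (3 * n + 1) div 2" using that by linarith
    moreover have "?f n = fps_X ^ (n * (3 * n + 1) div 2) * ((-1) ^ n * (1 - fps_X ^ (2 * n + 1)))"
      by (simp only: mult_ac)
    ultimately show ?thesis by (simp only: fps_X_power_mult_nth if_True)
  qed
  have "(?f has_sum Abs_fps (\<lambda>i. \<Sum>n\<in>{k..i}. fps_nth (?f n) i)) {k..}"
    unfolding has_sum_def
  proof (rule tendsto_fpsI)
    fix i
    show "\<forall>\<^sub>F S in finite_subsets_at_top {k..}.
            fps_nth (sum ?f S) i = fps_nth (Abs_fps (\<lambda>i. \<Sum>n\<in>{k..i}. fps_nth (?f n) i)) i"
      unfolding eventually_finite_subsets_at_top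
    proof (intro exI[of _ "{k..i}"] conjI allI impI)
      fix S assume S: "finite S \<and> {k..i} \<subseteq> S \<and> S \<subseteq> {k..}"
      have "(\<Sum>n\<in>S. fps_nth (?f n) i) = (\<Sum>n\<in>{k..i}. fps_nth (?f n) i)"
        by (rule sum.mono_neutral_right) (use S z in auto)
      then show "fps_nth (sum ?f S) i = fps_nth (Abs_fps (\<lambda>i. \<Sum>n\<in>{k..i}. fps_nth (?f n) i)) i"
        by (simp only: fps_sum_nth fps_nth_Abs_fps)
    qed auto
  qed
  then show ?thesis by (auto simp: summable_on_def)
qed

end

theory Submission
  imports Defs
begin

text \<open>
  Only the factors \<open>1 - q^2\<close>, \<open>1 - q^3\<close>, \<open>1 - q^5\<close> of the denominator are needed: dividing the signed tail
  by them already gives nonnegative coefficients when \<open>k \<ge> 2\<close>, and these vanish beyond the leading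
  exponent \<open>e\<close> only at \<open>e + 1\<close> and, for \<open>k = 2\<close>, at \<open>e + 13\<close> and \<open>e + 16\<close>.  The remaining
  factors contribute a series with nonnegative coefficients starting with \<open>1 + 0 q\<close> and containing
  \<open>q^4\<close>, which fills the two exceptional gaps.
  The number of partitions into parts \<open>2\<close>, \<open>3\<close>, \<open>5\<close> differs from \<open>(x + 5)\<^sup>2 / 60\<close> by a bounded amount.
  The alternating sum over the tail therefore has coefficients \<open>k (2 m + k + 12) / 60\<close> up to a bounded
  error per term and the effect of truncation at the last term; the main term dominates both except in
  finitely many cases with \<open>k \<le> 5\<close>, which are computed.
\<close>

section \<open>Quasi-polynomial count of partitions into parts 2, 3 and 5\<close>

text \<open>
  The number of partitions of \<open>x\<close> into parts \<open>2\<close>, \<open>3\<close>, \<open>5\<close> is \<open>((x + 5)\<^sup>2 + wobble x) / 60\<close>.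
  Since \<open>2\<close>, \<open>3\<close>, \<open>5\<close> are pairwise coprime, all poles of the generating function other than \<open>1\<close>
  are simple, so the fluctuation \<open>wobble\<close> is a sum of three periodic functions.
\<close>

definition wobble2 :: "int \<Rightarrow> int" where
  "wobble2 x = (if even x then 35 else 20)"

definition wobble3 :: "int \<Rightarrow> int" where
  "wobble3 x = (if x mod 3 = 1 then - 20 else 0)"

definition wobble5 :: "int \<Rightarrow> int" where
  "wobble5 x = (if x mod 5 = 0 then 0 else if x mod 5 = 1 \<or> x mod 5 = 4 then - 36 else - 24)"

definition wobble :: "int \<Rightarrow> int" where
  "wobble x = wobble2 x + wobble3 x + wobble5 x"

text \<open>All counts are multiplied by \<open>60\<close> to stay in the integers.\<close>

definition parts235 :: "int \<Rightarrow> int" where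
  "parts235 x = (if x < 0 then 0 else (x + 5)\<^sup>2 + wobble x)"

lemma wobble_bounds: "- 36 \<le> wobble x" "wobble x \<le> 35"
  by (auto simp: wobble_def wobble2_def wobble3_def wobble5_def)

lemma wobble2_shift: "wobble2 (x - 2 * n) = wobble2 x"
  by (simp add: wobble2_def)

lemma wobble3_shift: "wobble3 (x - 3 * n) = wobble3 x"
proof -
  have "(x - 3 * n) mod 3 = x mod 3" by presburger
  then show ?thesis by (simp add: wobble3_def)
qed

lemma wobble5_shift: "wobble5 (x - 5 * n) = wobble5 x"
proof -
  have "(x - 5 * n) mod 5 = x mod 5" by presburger
  then show ?thesis by (simp add: wobble5_def)
qed

text \<open>The factor \<open>1 - q^p\<close> of the denominator annihilates period
  \<open>p\<close>, so for each of the three components the six terms cancel in pairs.\<close>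

lemma wobble_recurrence:
  "wobble x - wobble (x - 2) - wobble (x - 3) + wobble (x - 7) + wobble (x - 8) = wobble (x - 10)"
  using wobble2_shift[of x 1] wobble2_shift[of x 4] wobble2_shift[of x 5] wobble2_shift[of "x - 3" 2]
    wobble3_shift[of x 1] wobble3_shift[of "x - 2" 2] wobble3_shift[of "x - 7" 1]
    wobble5_shift[of x 2] wobble5_shift[of "x - 2" 1] wobble5_shift[of "x - 3" 1]
  by (simp add: wobble_def)

text \<open>The quasi-polynomial vanishes from -9 to -1, so one formula covers every argument in the
  recurrence for \<open>x > 0\<close>; at -10 it would give 60.\<close>

lemma parts235_eq: "parts235 x = (x + 5)\<^sup>2 + wobble x" if "x \<ge> - 9"
proof (cases "x < 0")
  case True
  with that have "x \<in> {-9, -8, -7, -6, -5, -4, -3, -2, -1}" by auto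
  then show ?thesis
    by (auto simp: parts235_def wobble_def wobble2_def wobble3_def wobble5_def)
qed (simp add: parts235_def)

lemma parts235_recurrence:
  assumes "x \<ge> 0"
  shows "parts235 x - parts235 (x - 2) - parts235 (x - 3) + parts235 (x - 7) + parts235 (x - 8)
           - parts235 (x - 10) = (if x = 0 then 60 else 0)"
proof (cases "x = 0")
  case True
  then show ?thesis
    by (simp add: parts235_def wobble_def wobble2_def wobble3_def wobble5_def)
next
  case False
  with assms show ?thesis
    using wobble_recurrence[of x] by (simp add: parts235_eq power2_eq_square algebra_simps)
qed

lemma parts235_pos:
  assumes "x \<ge> 0" "x \<noteq> 1"
  shows "parts235 x > 0"
proof (cases "x = 0")
  case False
  with assms have "7 * 7 \<le> (x + 5) * (x + 5)" by (intro mult_mono) auto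
  with False assms show ?thesis
    using wobble_bounds[of x] by (simp add: parts235_def power2_eq_square)
qed (simp add: parts235_def wobble_def wobble2_def wobble3_def wobble5_def)

section \<open>Tail coefficients: recursion, approximation, positivity\<close>

text \<open>
  \<open>60\<close> times the coefficient of \<open>q ^ (m + k * (3 * k + 1) / 2)\<close> in the signed tail divided by
  \<open>(1 - q^2) * (1 - q^3) * (1 - q^5)\<close>; splitting off the first term of the tail gives the recursion.
\<close>

function tail_coeff :: "int \<Rightarrow> int \<Rightarrow> int" where
  "tail_coeff k m = (if m < 0 \<or> k < 0 then 0 else
     parts235 m - parts235 (m - 2 * k - 1) - tail_coeff (k + 1) (m - 3 * k - 2))"
  by auto
termination by (relation "Wellfounded.measure (\<lambda>(k, m). nat (m + 1))") auto

declare tail_coeff.simps [simp del]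

text \<open>Below \<open>3 * k + 2\<close>, the gap between consecutive leading exponents, only the
  first term of the tail contributes.\<close>

lemma tail_coeff_eq:
  assumes "k \<ge> 0" "m < 3 * k + 2"
  shows "tail_coeff k m = parts235 m - parts235 (m - 2 * k - 1)"
  using assms by (auto simp: tail_coeff.simps[of k m] tail_coeff.simps[of "k + 1"] parts235_def)

lemma parts235_diff:
  assumes "d \<ge> 0" "m \<ge> d"
  shows "\<bar>parts235 m - parts235 (m - d) - d * (2 * m + 10 - d)\<bar> \<le> 71"
proof -
  have "parts235 m - parts235 (m - d) - d * (2 * m + 10 - d) = wobble m - wobble (m - d)"
    using assms by (simp add: parts235_def power2_eq_square algebra_simps)
  then show ?thesis
    using wobble_bounds[of m] wobble_bounds[of "m - d"] by linarith
qed

text \<open>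
  The approximation \<open>k * (2 * m + k + 12)\<close> is the polynomial that satisfies the recursion exactly
  when \<open>wobble\<close> and the truncation at negative arguments are ignored.  The witness \<open>J\<close> below is the
  number of recursive calls, each of which contributes an error of at most \<open>71 = 35 + 36\<close>.
\<close>

lemma tail_coeff_approx_base:
  assumes "k \<ge> 0" "m \<ge> 0" "m < 3 * k + 2"
  shows "\<bar>tail_coeff k m - k * (2 * m + k + 12)\<bar> \<le> 2 * k\<^sup>2 + 2 * k + 107"
proof (cases "m \<le> 2 * k")
  case True
  have "\<bar>m - k\<bar> ^ 2 \<le> k ^ 2"
    using True assms by (intro power_mono) auto
  then have "(m - k)\<^sup>2 \<le> k\<^sup>2" by simp
  moreover have "0 \<le> (m - k + 5)\<^sup>2" by simp
  then have "- 10 * (m - k) - 25 \<le> (m - k)\<^sup>2" by (simp add: power2_eq_square algebra_simps)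
  moreover have "0 \<le> (k - 1)\<^sup>2" by simp
  then have "2 * k \<le> k\<^sup>2 + 1" by (simp add: power2_eq_square algebra_simps)
  moreover have "tail_coeff k m = (m + 5)\<^sup>2 + wobble m"
    using True assms by (simp add: tail_coeff_eq) (simp add: parts235_def)
  then have "tail_coeff k m - k * (2 * m + k + 12)
      = (m - k)\<^sup>2 - 2 * k\<^sup>2 + 10 * m - 12 * k + 25 + wobble m"
    by algebra
  ultimately show ?thesis
    using wobble_bounds[of m] True assms unfolding abs_le_iff by smt
next
  case False
  define x where "x = m - 2 * k - 1"
  have x: "m = x + 2 * k + 1" "0 \<le> x" "x \<le> k" using False assms by (auto simp: x_def)
  have "k * x \<le> k * k" "0 \<le> k * x" using x assms by (auto intro: mult_left_mono)
  moreover have "0 \<le> k * k" by simp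
  \<comment> \<open>The error here is at most \<open>k^2 + 12 * k + 82\<close>; the claimed bound
    exceeds this by exactly \<open>(k - 5)^2\<close>, which fixes the constant 107.\<close>
  moreover have "0 \<le> (k - 5) * (k - 5)" by simp
  moreover have "\<bar>tail_coeff k m - (2 * k + 1) * (2 * m + 9 - 2 * k)\<bar> \<le> 71"
    using parts235_diff[of "2 * k + 1" m] x assms by (simp add: tail_coeff_eq diff_diff_eq)
  moreover have "(2 * k + 1) * (2 * m + 9 - 2 * k) - k * (2 * m + k + 12)
      = 2 * (k * x) + 2 * x + 11 + 10 * k - k * k"
    unfolding x(1) by algebra
  moreover have "(k - 5) * (k - 5) = k * k - 10 * k + 25" by algebra
  ultimately show ?thesis
    using x assms unfolding power2_eq_square abs_le_iff by smt
qed

text \<open>Errors add up along the recursion until level \<open>k + J\<close>, where the base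
  estimate applies. The bounds on \<open>2 * m\<close> place the exponent between the leading
  exponents of the terms \<open>k + J\<close> and \<open>k + J + 1\<close>.\<close>

lemma tail_coeff_approx:
  assumes "k \<ge> 0" "m \<ge> 0"
  shows "\<exists>J\<ge>0. 6 * k * J + J * (3 * J + 1) \<le> 2 * m \<and> 2 * m < 6 * k * (J + 1) + (J + 1) * (3 * J + 4) \<and>
           \<bar>tail_coeff k m - k * (2 * m + k + 12)\<bar> \<le> 71 * J + 2 * (k + J)\<^sup>2 + 2 * (k + J) + 107"
  using assms
proof (induction k m rule: tail_coeff.induct)
  case (1 k m)
  show ?case
  proof (cases "m < 3 * k + 2")
    case True
    with tail_coeff_approx_base[of k m] 1 show ?thesis
      by (intro exI[of _ 0]) auto
  next
    case False
    with 1 obtain J where J: "J \<ge> 0"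
      "6 * (k + 1) * J + J * (3 * J + 1) \<le> 2 * (m - 3 * k - 2)"
      "2 * (m - 3 * k - 2) < 6 * (k + 1) * (J + 1) + (J + 1) * (3 * J + 4)"
      "\<bar>tail_coeff (k + 1) (m - 3 * k - 2) - (k + 1) * (2 * (m - 3 * k - 2) + (k + 1) + 12)\<bar>
         \<le> 71 * J + 2 * (k + 1 + J)\<^sup>2 + 2 * (k + 1 + J) + 107"
      by auto
    have "tail_coeff k m = parts235 m - parts235 (m - (2 * k + 1)) - tail_coeff (k + 1) (m - 3 * k - 2)"
      using 1 by (simp add: tail_coeff.simps[of k m] diff_diff_eq)
    moreover have "\<bar>parts235 m - parts235 (m - (2 * k + 1)) - (2 * k + 1) * (2 * m + 10 - (2 * k + 1))\<bar> \<le> 71"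
      using 1 False by (intro parts235_diff) auto
    moreover have "(2 * k + 1) * (2 * m + 10 - (2 * k + 1)) - (k + 1) * (2 * (m - 3 * k - 2) + (k + 1) + 12)
        = k * (2 * m + k + 12)"
      by algebra
    ultimately have "\<bar>tail_coeff k m - k * (2 * m + k + 12)\<bar>
        \<le> 71 * (J + 1) + 2 * (k + (J + 1))\<^sup>2 + 2 * (k + (J + 1)) + 107"
      using J(4) by (simp add: add.assoc add.commute[of 1]) 
    with J show ?thesis
      by (intro exI[of _ "J + 1"]) (auto simp: algebra_simps)
  qed
qed

lemma tail_coeff_pos_base:
  assumes "k \<ge> 2" "m \<ge> 0" "m \<noteq> 1" "m < 3 * k + 2"
  shows "tail_coeff k m > 0"
proof (cases "m \<le> 2 * k")
  case True
  then have "tail_coeff k m = parts235 m"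
    using assms by (simp add: tail_coeff_eq) (simp add: parts235_def)
  then show ?thesis using assms parts235_pos by simp
next
  case False
  \<comment> \<open>The main term is at least 75, which beats the error 71.\<close>
  have "5 * 15 \<le> (2 * k + 1) * (2 * m + 10 - (2 * k + 1))"
    using assms False by (intro mult_mono) auto
  then show ?thesis
    using parts235_diff[of "2 * k + 1" m] assms False by (simp add: tail_coeff_eq diff_diff_eq)
qed

lemma tail_coeff_one: "k \<ge> 2 \<Longrightarrow> tail_coeff k 1 = 0"
  by (simp add: tail_coeff_eq parts235_def wobble_def wobble2_def wobble3_def wobble5_def)

text \<open>For \<open>k = 2\<close>, \<open>J <= 15\<close> in \<open>tail_coeff_approx\<close>
  gives \<open>2 * m < 976\<close>; for larger \<open>J\<close> the approximation alone yields
  positivity.\<close>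

lemma tail_coeff_2_small:
  "list_all (\<lambda>m. tail_coeff 2 m > 0 \<or> m = 1 \<or> (m = 13 \<or> m = 16) \<and> tail_coeff 2 m = 0) [0..487]"
  by code_simp

text \<open>These ranges correspond to \<open>J <= 6\<close>, \<open>J <= 3\<close> and
  \<open>J <= 1\<close>.\<close>

lemma tail_coeff_small:
  "list_all (\<lambda>m. tail_coeff 3 m > 0 \<or> m = 1) [0..139]"
  "list_all (\<lambda>m. tail_coeff 4 m > 0 \<or> m = 1) [0..73]"
  "list_all (\<lambda>m. tail_coeff 5 m > 0 \<or> m = 1) [0..36]"
  by code_simp+

lemma tail_coeff_pos:
  assumes "k \<ge> 2" "m \<ge> 0" "m \<noteq> 1"
  shows "tail_coeff k m > 0 \<or> k = 2 \<and> (m = 13 \<or> m = 16) \<and> tail_coeff k m = 0"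
proof -
  obtain J where J: "J \<ge> 0" "6 * k * J + J * (3 * J + 1) \<le> 2 * m"
      "2 * m < 6 * k * (J + 1) + (J + 1) * (3 * J + 4)"
      "\<bar>tail_coeff k m - k * (2 * m + k + 12)\<bar> \<le> 71 * J + 2 * (k + J)\<^sup>2 + 2 * (k + J) + 107"
    using tail_coeff_approx[of k m] assms by auto
  have pos: "tail_coeff k m > 0"
    if "71 * J + 2 * (k + J)\<^sup>2 + 2 * (k + J) + 107 < k * ((6 * k * J + J * (3 * J + 1)) + k + 12)"
  proof -
    have "k * ((6 * k * J + J * (3 * J + 1)) + k + 12) \<le> k * (2 * m + k + 12)"
      using J(2) assms by (intro mult_left_mono) auto
    then show ?thesis using J(4) that by linarith
  qed
  have m_less: "2 * m < 6 * k * (j + 1) + (j + 1) * (3 * j + 4)" if "J \<le> j" for j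
  proof -
    have "6 * k * (J + 1) \<le> 6 * k * (j + 1)" "(J + 1) * (3 * J + 4) \<le> (j + 1) * (3 * j + 4)"
      using that J(1) assms by (auto intro!: mult_mono)
    then show ?thesis using J(3) by linarith
  qed
  consider "J = 0" | "J \<ge> 1" "k \<ge> 6" | "J \<ge> 1" "k = 2" | "J \<ge> 1" "k = 3" | "J \<ge> 1" "k = 4" | "J \<ge> 1" "k = 5"
    using J(1) assms(1) by fastforce
  then show ?thesis
  proof cases
    case 1
    then show ?thesis using J(3) tail_coeff_pos_base[of k m] assms by simp
  next
    case 2
    \<comment> \<open>After this shift the difference of the two sides has only positive
      coefficients in \<open>a\<close> and \<open>b\<close>, with constant term 58.\<close>
    define a b where "a = k - 6" and "b = J - 1"
    then have k: "k = a + 6" "J = b + 1" "a \<ge> 0" "b \<ge> 0" using 2 by auto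
    have "71 * J + 2 * (k + J)\<^sup>2 + 2 * (k + J) + 107 < k * ((6 * k * J + J * (3 * J + 1)) + k + 12)"
      using k(3,4) unfolding k(1,2)
      by (simp add: algebra_simps power2_eq_square) (intro add_pos_nonneg add_nonneg_nonneg mult_nonneg_nonneg; simp)
    with pos show ?thesis by blast
  next
    case 3
    show ?thesis
    proof (cases "J \<ge> 16")
      case True
      then have "16 * J \<le> J * J" by (intro mult_right_mono) auto
      with True have "71 * J + 2 * (k + J)\<^sup>2 + 2 * (k + J) + 107 < k * ((6 * k * J + J * (3 * J + 1)) + k + 12)"
        unfolding 3(2) power2_eq_square ring_distribs by linarith
      with pos show ?thesis by blast
    next
      case False
      then have "m \<in> set [0..487]" using m_less[of 15] 3 assms by simp
      then show ?thesis using tail_coeff_2_small 3 assms unfolding list_all_iff by blast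
    qed
  next
    case 4
    show ?thesis
    proof (cases "J \<ge> 7")
      case True
      then have "7 * J \<le> J * J" by (intro mult_right_mono) auto
      with True have "71 * J + 2 * (k + J)\<^sup>2 + 2 * (k + J) + 107 < k * ((6 * k * J + J * (3 * J + 1)) + k + 12)"
        unfolding 4(2) power2_eq_square ring_distribs by linarith
      with pos show ?thesis by blast
    next
      case False
      then have "m \<in> set [0..139]" using m_less[of 6] 4 assms by simp
      then show ?thesis using tail_coeff_small(1) 4 assms unfolding list_all_iff by blast
    qed
  next
    case 5
    show ?thesis
    proof (cases "J \<ge> 4")
      case True
      then have "4 * J \<le> J * J" by (intro mult_right_mono) auto
      with True have "71 * J + 2 * (k + J)\<^sup>2 + 2 * (k + J) + 107 < k * ((6 * k * J + J * (3 * J + 1)) + k + 12)"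
        unfolding 5(2) power2_eq_square ring_distribs by linarith
      with pos show ?thesis by blast
    next
      case False
      then have "m \<in> set [0..73]" using m_less[of 3] 5 assms by simp
      then show ?thesis using tail_coeff_small(2) 5 assms unfolding list_all_iff by blast
    qed
  next
    case 6
    show ?thesis
    proof (cases "J \<ge> 2")
      case True
      then have "2 * J \<le> J * J" by (intro mult_right_mono) auto
      with True have "71 * J + 2 * (k + J)\<^sup>2 + 2 * (k + J) + 107 < k * ((6 * k * J + J * (3 * J + 1)) + k + 12)"
        unfolding 6(2) power2_eq_square ring_distribs by linarith
      with pos show ?thesis by blast
    next
      case False
      then have "m \<in> set [0..36]" using m_less[of 1] 6 assms by simp
      then show ?thesis using tail_coeff_small(3) 6 assms unfolding list_all_iff by blast
    qed
  qed
qed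

section \<open>Generating function of \<open>parts235\<close>\<close>

definition fps235 :: "real fps" where
  "fps235 = Abs_fps (\<lambda>n. real_of_int (parts235 (int n)))"

lemma fps_nth_fps235_mult_X_power: "fps_nth (fps_X ^ r * fps235) n = real_of_int (parts235 (int n - int r))"
  by (simp add: fps_X_power_mult_nth fps235_def parts235_def of_nat_diff)

lemma fps235_inverse:
  "(1 - fps_X ^ 2) * (1 - fps_X ^ 3) * (1 - fps_X ^ 5) * fps235 = fps_const 60"
proof (rule fps_ext)
  fix n
  \<comment> \<open>The \<open>q^5\<close> terms cancel; \<open>fps_X ^ 0\<close> lets the shift
    lemma apply to every summand.\<close>
  have "(1 - fps_X ^ 2) * (1 - fps_X ^ 3) * (1 - fps_X ^ 5) * fps235
      = fps_X ^ 0 * fps235 - fps_X ^ 2 * fps235 - fps_X ^ 3 * fps235 + fps_X ^ 7 * fps235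
        + fps_X ^ 8 * fps235 - fps_X ^ 10 * fps235"
    by (simp add: algebra_simps numeral_eq_Suc)
  then have "fps_nth ((1 - fps_X ^ 2) * (1 - fps_X ^ 3) * (1 - fps_X ^ 5) * fps235) n
      = real_of_int (parts235 (int n) - parts235 (int n - 2) - parts235 (int n - 3)
          + parts235 (int n - 7) + parts235 (int n - 8) - parts235 (int n - 10))"
    by (simp only: fps_add_nth fps_sub_nth fps_nth_fps235_mult_X_power) simp
  also have "\<dots> = fps_nth (fps_const 60) n"
    by (subst parts235_recurrence) auto
  finally show "fps_nth ((1 - fps_X ^ 2) * (1 - fps_X ^ 3) * (1 - fps_X ^ 5) * fps235) n
      = fps_nth (fps_const 60) n" .
qed

section \<open>The tail as a formal power series\<close>

abbreviation pentagonal :: "nat \<Rightarrow> nat" where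
  "pentagonal n \<equiv> n * (3 * n + 1) div 2"

lemma pentagonal_Suc: "pentagonal (Suc n) = pentagonal n + (3 * n + 2)"
proof -
  have "Suc n * (3 * Suc n + 1) = n * (3 * n + 1) + (3 * n + 2) * 2"
    by (simp add: algebra_simps)
  then show ?thesis by simp
qed

lemma le_pentagonal: "n \<le> pentagonal n"
  by (induction n) (simp, simp only: pentagonal_Suc)

abbreviation pent_term :: "nat \<Rightarrow> real fps" where
  "pent_term n \<equiv> (-1) ^ n * fps_X ^ (pentagonal n) * (1 - fps_X ^ (2 * n + 1))"

lemma fps_nth_pent_term_eq_0:
  assumes "i < pentagonal n"
  shows "fps_nth (pent_term n) i = 0"
proof -
  have "pent_term n = fps_X ^ pentagonal n * ((-1) ^ n * (1 - fps_X ^ (2 * n + 1)))"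
    by (simp only: mult_ac)
  then show ?thesis using assms by (simp only: fps_X_power_mult_nth if_True)
qed

definition pent_tail :: "nat \<Rightarrow> real fps" where
  "pent_tail k = (\<Sum>\<^sub>\<infinity>n\<in>{k..}. pent_term n)"

text \<open>Terms with \<open>n > i\<close> do not reach \<open>q^i\<close>, so a finite set
  witnessing convergence can be enlarged by \<open>{k..i}\<close> and then cut down to it.\<close>

lemma fps_nth_pent_tail: "fps_nth (pent_tail k) i = (\<Sum>n\<in>{k..i}. fps_nth (pent_term n) i)"
proof -
  have "(pent_term has_sum pent_tail k) {k..}"
    using has_sum_infsum[OF summable_on_truncated_series[of k]] by (simp only: pent_tail_def)
  then have "\<forall>\<^sub>F S in finite_subsets_at_top {k..}. fps_nth (sum pent_term S) i = fps_nth (pent_tail k) i"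
    unfolding has_sum_def tendsto_fps_iff by (rule spec)
  then obtain X where X: "finite X" "X \<subseteq> {k..}"
    and sum_eq: "\<forall>S. finite S \<and> X \<subseteq> S \<and> S \<subseteq> {k..} \<longrightarrow> fps_nth (sum pent_term S) i = fps_nth (pent_tail k) i"
    unfolding eventually_finite_subsets_at_top by (elim exE conjE)
  have "finite (X \<union> {k..i}) \<and> X \<subseteq> X \<union> {k..i} \<and> X \<union> {k..i} \<subseteq> {k..}"
    using X by auto
  then have "fps_nth (pent_tail k) i = fps_nth (sum pent_term (X \<union> {k..i})) i"
    using sum_eq[THEN spec, THEN mp, symmetric] by blast
  also have "\<dots> = (\<Sum>n\<in>X \<union> {k..i}. fps_nth (pent_term n) i)"
    by (simp only: fps_sum_nth)
  also have "\<dots> = (\<Sum>n\<in>{k..i}. fps_nth (pent_term n) i)"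
  proof (rule sum.mono_neutral_right)
    show "\<forall>n\<in>X \<union> {k..i} - {k..i}. fps_nth (pent_term n) i = 0"
    proof
      fix n assume "n \<in> X \<union> {k..i} - {k..i}"
      with X(2) have "i < n" by auto
      with le_pentagonal[of n] show "fps_nth (pent_term n) i = 0"
        by (intro fps_nth_pent_term_eq_0) linarith
    qed
  qed (use X(1) in auto)
  finally show ?thesis .
qed

lemma pent_tail_Suc: "pent_tail k = pent_term k + pent_tail (Suc k)"
proof (rule fps_ext)
  fix i
  show "fps_nth (pent_tail k) i = fps_nth (pent_term k + pent_tail (Suc k)) i"
  proof (cases "k \<le> i")
    case True
    then show ?thesis
      unfolding fps_add_nth fps_nth_pent_tail by (rule sum.atLeast_Suc_atMost)
  next
    case False
    with le_pentagonal[of k] have "fps_nth (pent_term k) i = 0"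
      by (intro fps_nth_pent_term_eq_0) linarith
    with False show ?thesis
      unfolding fps_add_nth fps_nth_pent_tail by simp
  qed
qed

lemma fps_nth_pent_tail_eq_0:
  assumes "i < pentagonal k"
  shows "fps_nth (pent_tail k) i = 0"
  unfolding fps_nth_pent_tail
proof (rule sum.neutral, rule ballI)
  fix n assume "n \<in> {k..i}"
  then have "pentagonal k \<le> pentagonal n"
    by (intro div_le_mono mult_le_mono) auto
  with assms show "fps_nth (pent_term n) i = 0"
    by (intro fps_nth_pent_term_eq_0) linarith
qed

lemma fps_nth_pent_tail_mult_eq_0:
  assumes "i < pentagonal k"
  shows "fps_nth (pent_tail k * F) i = 0"
  unfolding fps_mult_nth
  by (rule sum.neutral) (use assms in \<open>auto intro!: mult_eq_0_iff[THEN iffD2] disjI1 fps_nth_pent_tail_eq_0\<close>)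

text \<open>Ring identity for splitting off the first term, with \<open>a\<close> as
  \<open>(-1) ^ k\<close>, \<open>Q * R\<close> as \<open>fps_X ^ (2 * k + 1)\<close> and
  \<open>T\<close> as the rest of the tail.\<close>

lemma sign_rearrange:
  fixes a P Q R T F :: "'a :: comm_ring_1"
  assumes "a * a = 1"
  shows "a * (a * P * (1 - Q * R) + T) * F = P * F - P * (Q * R) * F - - 1 * a * T * F"
proof -
  have "a * (a * P * (1 - Q * R) + T) * F = (a * a) * P * (1 - Q * R) * F + a * T * F"
    by (simp add: algebra_simps)
  then show ?thesis
    unfolding assms by (simp add: algebra_simps)
qed

text \<open>Passing to \<open>Suc k\<close> lowers the offset by \<open>3 * k + 2\<close>, as in the
  recursion of \<open>tail_coeff\<close>; a negative offset gives 0 on both sides.\<close>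

lemma fps_nth_pent_tail_fps235:
  "fps_nth ((-1) ^ k * pent_tail k * fps235) (pentagonal k + m) = real_of_int (tail_coeff (int k) (int m))"
proof (induction m arbitrary: k rule: less_induct)
  case (less m)
  have *: "(-1) ^ k * pent_tail k * fps235
      = fps_X ^ pentagonal k * fps235 - fps_X ^ (pentagonal k + (2 * k + 1)) * fps235
        - (-1) ^ Suc k * pent_tail (Suc k) * fps235"
  proof -
    have "(-1) ^ k * (-1) ^ k = (1 :: real fps)"
      by (simp flip: power_mult_distrib)
    then show ?thesis
      unfolding pent_tail_Suc[of k] power_add[of fps_X] power_Suc by (rule sign_rearrange)
  qed
  have "fps_nth ((-1) ^ Suc k * pent_tail (Suc k) * fps235) (pentagonal k + m)
      = real_of_int (tail_coeff (int k + 1) (int m - 3 * int k - 2))"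
  proof (cases "m < 3 * k + 2")
    case True
    then have "fps_nth (pent_tail (Suc k) * ((-1) ^ Suc k * fps235)) (pentagonal k + m) = 0"
      by (intro fps_nth_pent_tail_mult_eq_0) (simp only: pentagonal_Suc)
    with True show ?thesis
      by (subst tail_coeff.simps) (simp add: mult_ac)
  next
    case False
    then have "pentagonal k + m = pentagonal (Suc k) + (m - (3 * k + 2))"
      by (simp only: pentagonal_Suc)
    with False less[of "m - (3 * k + 2)" "Suc k"] show ?thesis
      by (simp only: ) (simp add: of_nat_diff algebra_simps)
  qed
  then show ?case
    unfolding * by (subst tail_coeff.simps)
      (simp only: fps_sub_nth fps_nth_fps235_mult_X_power, simp add: algebra_simps)
qed

section \<open>Infinite products and their reciprocals\<close>

lemma qpochhammer_inf_fps_tendsto: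
  fixes m r :: nat
  assumes "m > 0" "r > 0"
  shows "\<forall>\<^sub>F n in sequentially. fps_nth (\<Prod>j\<le>n. 1 - fps_X ^ m * (fps_X ^ r) ^ j) i
           = fps_nth (qpochhammer_inf (fps_X ^ m) (fps_X ^ r) :: real fps) i"
proof -
  let ?f = "\<lambda>j. 1 - fps_X ^ m * (fps_X ^ r) ^ j :: real fps"
  let ?Q = "qpochhammer_inf (fps_X ^ m) (fps_X ^ r) :: real fps"
  have "?Q \<noteq> 0"
    using has_prod_qpochhammer_inf_fps(2)[OF assms] by auto
  \<comment> \<open>A nonzero value rules out the alternative of \<open>has_prod\<close> that skips
    zero factors.\<close>
  with has_prod_qpochhammer_inf_fps(1)[OF assms] have "raw_has_prod ?f 0 ?Q"
    unfolding has_prod_def by blast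
  then have "(\<lambda>n. \<Prod>j\<le>n. ?f j) \<longlonglongrightarrow> ?Q"
    unfolding raw_has_prod_def by simp
  then show ?thesis
    unfolding tendsto_fps_iff by (rule spec)
qed

lemma fps_nth_qpochhammer_inf_less:
  fixes m r :: nat
  assumes "i < m" "r > 0"
  shows "fps_nth (qpochhammer_inf (fps_X ^ m) (fps_X ^ r) :: real fps) i = fps_nth 1 i"
proof -
  have "fps_nth (\<Prod>j\<le>n. 1 - fps_X ^ m * (fps_X ^ r) ^ j :: real fps) i = fps_nth 1 i" for n
  proof (induction n)
    case (Suc n)
    let ?F = "\<Prod>j\<le>n. 1 - fps_X ^ m * (fps_X ^ r) ^ j :: real fps"
    have "(\<Prod>j\<le>Suc n. 1 - fps_X ^ m * (fps_X ^ r) ^ j :: real fps)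
        = ?F - fps_X ^ m * ((fps_X ^ r) ^ Suc n * ?F)"
      by (simp add: algebra_simps)
    then have "fps_nth (\<Prod>j\<le>Suc n. 1 - fps_X ^ m * (fps_X ^ r) ^ j :: real fps) i = fps_nth ?F i"
      using assms by (simp only: fps_sub_nth fps_X_power_mult_nth) simp
    with Suc show ?case by simp
  qed (use assms in simp)
  then show ?thesis
    using eventually_happens[OF qpochhammer_inf_fps_tendsto[of m r i]] assms by auto
qed

lemma qpochhammer_inf_fps_shift:
  fixes m r :: nat
  assumes "m > 0" "r > 0"
  shows "qpochhammer_inf (fps_X ^ m) (fps_X ^ r)
           = (1 - fps_X ^ m) * (qpochhammer_inf (fps_X ^ (m + r)) (fps_X ^ r) :: real fps)"
proof (rule fps_ext)
  fix i
  let ?Q = "\<lambda>m. qpochhammer_inf (fps_X ^ m) (fps_X ^ r) :: real fps"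
  let ?P = "\<lambda>m n. \<Prod>j\<le>n. 1 - fps_X ^ m * (fps_X ^ r) ^ j :: real fps"
  have mult: "fps_nth ((1 - fps_X ^ m) * F) i = fps_nth F i - (if i < m then 0 else fps_nth F (i - m))"
    for F :: "real fps"
    by (simp add: left_diff_distrib fps_X_power_mult_nth)
  have "\<forall>\<^sub>F n in sequentially. fps_nth (?P m (Suc n)) i = fps_nth (?Q m) i"
    using qpochhammer_inf_fps_tendsto[OF assms, of i] by (rule eventually_sequentially_Suc[THEN iffD2])
  moreover have "\<forall>\<^sub>F n in sequentially. fps_nth (?P (m + r) n) l = fps_nth (?Q (m + r)) l" for l
    using assms by (intro qpochhammer_inf_fps_tendsto) auto
  \<comment> \<open>Multiplication by \<open>1 - fps_X ^ m\<close> involves only the coefficients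
    \<open>i\<close> and \<open>i - m\<close>, so one common \<open>n\<close> suffices.\<close>
  then have "\<forall>\<^sub>F n in sequentially. fps_nth (?P (m + r) n) i = fps_nth (?Q (m + r)) i \<and>
      fps_nth (?P (m + r) n) (i - m) = fps_nth (?Q (m + r)) (i - m)"
    by (intro eventually_conj) auto
  ultimately have "\<forall>\<^sub>F n in sequentially. fps_nth (?P m (Suc n)) i = fps_nth (?Q m) i \<and>
      fps_nth (?P (m + r) n) i = fps_nth (?Q (m + r)) i \<and>
      fps_nth (?P (m + r) n) (i - m) = fps_nth (?Q (m + r)) (i - m)"
    by (rule eventually_conj)
  then obtain n where n: "fps_nth (?P m (Suc n)) i = fps_nth (?Q m) i"
      "fps_nth (?P (m + r) n) i = fps_nth (?Q (m + r)) i"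
      "fps_nth (?P (m + r) n) (i - m) = fps_nth (?Q (m + r)) (i - m)"
    using eventually_happens by force
  have "?P m (Suc n) = (1 - fps_X ^ m) * ?P (m + r) n"
    unfolding prod.atMost_Suc_shift by (simp add: power_add mult_ac)
  with n show "fps_nth (?Q m) i = fps_nth ((1 - fps_X ^ m) * ?Q (m + r)) i"
    by (simp only: mult)
qed

lemma inverse_qpochhammer_inf_fps_shift:
  fixes m r :: nat
  assumes "m > 0" "r > 0"
  shows "(1 - fps_X ^ m) * inverse (qpochhammer_inf (fps_X ^ m) (fps_X ^ r) :: real fps)
           = inverse (qpochhammer_inf (fps_X ^ (m + r)) (fps_X ^ r))"
proof -
  have "inverse (1 - fps_X ^ m) * (1 - fps_X ^ m :: real fps) = 1"
    using assms by (intro inverse_mult_eq_1) simp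
  then show ?thesis
    unfolding qpochhammer_inf_fps_shift[OF assms] fps_inverse_mult
    by (simp flip: mult.assoc) (simp add: mult_ac)
qed

lemma fps_nth_inverse_qpochhammer_inf_less:
  fixes m r :: nat
  assumes "i < m" "r > 0"
  shows "fps_nth (inverse (qpochhammer_inf (fps_X ^ m) (fps_X ^ r) :: real fps)) i = fps_nth 1 i"
proof -
  let ?Q = "qpochhammer_inf (fps_X ^ m) (fps_X ^ r) :: real fps"
  have "fps_nth ?Q 0 = 1"
    using assms by (intro has_prod_qpochhammer_inf_fps) auto
  then have "?Q * inverse ?Q = 1"
    by (intro inverse_mult_eq_1') simp
  then have "fps_nth 1 i = (\<Sum>j=0..i. fps_nth ?Q j * fps_nth (inverse ?Q) (i - j))"
    by (metis fps_mult_nth)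
  also have "\<dots> = (\<Sum>j=0..i. if j = 0 then fps_nth (inverse ?Q) i else 0)"
    using assms by (intro sum.cong) (auto simp: fps_nth_qpochhammer_inf_less)
  finally show ?thesis by simp
qed

text \<open>The reciprocal counts partitions into parts \<open>m\<close>, \<open>m + r\<close>, and
  so on: either \<open>m\<close> is absent or one copy of it is removed. The measure drops as
  \<open>m\<close> grows or \<open>i\<close> shrinks.\<close>

lemma fps_nth_inverse_qpochhammer_inf_nonneg:
  fixes m r :: nat
  assumes "m > 0" "r > 0"
  shows "fps_nth (inverse (qpochhammer_inf (fps_X ^ m) (fps_X ^ r) :: real fps)) i \<ge> 0"
  using assms(1)
proof (induction "i + (i + 1 - m)" arbitrary: i m rule: less_induct)
  case less
  let ?R = "\<lambda>m. inverse (qpochhammer_inf (fps_X ^ m) (fps_X ^ r) :: real fps)"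
  show ?case
  proof (cases "i < m")
    case True
    with assms(2) show ?thesis
      by (simp add: fps_nth_inverse_qpochhammer_inf_less)
  next
    case False
    have "fps_nth (?R (m + r)) i = fps_nth ((1 - fps_X ^ m) * ?R m) i"
      by (simp only: inverse_qpochhammer_inf_fps_shift[OF less.prems assms(2)])
    also have "\<dots> = fps_nth (?R m) i - fps_nth (?R m) (i - m)"
      using False by (simp add: left_diff_distrib fps_X_power_mult_nth)
    finally have "fps_nth (?R m) i = fps_nth (?R (m + r)) i + fps_nth (?R m) (i - m)" by simp
    moreover have "fps_nth (?R (m + r)) i \<ge> 0"
      by (rule less.hyps) (use less.prems assms(2) False in linarith)+
    moreover have "fps_nth (?R m) (i - m) \<ge> 0"
      by (rule less.hyps) (use less.prems False in linarith)+
    ultimately show ?thesis by simp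
  qed
qed

section \<open>The remaining factors and the assembly\<close>

lemma fps_nth_mult_nonneg:
  fixes F G :: "'a :: linordered_semidom fps"
  assumes "\<And>i. fps_nth F i \<ge> 0" "\<And>i. fps_nth G i \<ge> 0"
  shows "fps_nth (F * G) i \<ge> 0"
  unfolding fps_mult_nth using assms by (intro sum_nonneg mult_nonneg_nonneg) auto

text \<open>With their first factors removed, the progressions from 2, 3 and 5 restart at 9, 10 and
  12.\<close>

definition cofactor :: "real fps" where
  "cofactor = inverse (qpochhammer_inf (fps_X ^ 9) (fps_X ^ 7)) * inverse (qpochhammer_inf (fps_X ^ 10) (fps_X ^ 7))
     * inverse (qpochhammer_inf (fps_X ^ 12) (fps_X ^ 7)) * inverse (qpochhammer_inf (fps_X ^ 4) (fps_X ^ 7))"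

lemma cofactor_nonneg: "fps_nth cofactor i \<ge> 0"
  unfolding cofactor_def
  by (intro fps_nth_mult_nonneg fps_nth_inverse_qpochhammer_inf_nonneg) auto

lemma fps_nth_cofactor_0: "fps_nth cofactor 0 = 1"
  by (simp add: cofactor_def fps_nth_inverse_qpochhammer_inf_less del: fps_inverse_nth_0)

lemma fps_nth_cofactor_1: "fps_nth cofactor 1 = 0"
  unfolding cofactor_def fps_mult_nth_1 by (simp only: fps_nth_inverse_qpochhammer_inf_less) simp

text \<open>Multiplying by \<open>1 - q^4\<close> only shifts one progression, so nonnegativity
  persists and the coefficient of \<open>q^4\<close> is at least that of \<open>q^0\<close>.\<close>

lemma fps_nth_cofactor_4: "fps_nth cofactor 4 > 0"
proof -
  have "fps_nth ((1 - fps_X ^ 4) * cofactor) 4 \<ge> 0"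
    unfolding cofactor_def mult.left_commute[of "1 - fps_X ^ 4"]
    by (subst inverse_qpochhammer_inf_fps_shift)
      (auto intro!: fps_nth_mult_nonneg fps_nth_inverse_qpochhammer_inf_nonneg)
  then show ?thesis
    by (simp add: left_diff_distrib fps_X_power_mult_nth fps_nth_cofactor_0)
qed

lemma truncated_series_eq:
  "fps_const 60 * truncated_series k = (-1) ^ k * pent_tail k * fps235 * cofactor"
proof -
  let ?Q = "\<lambda>m. qpochhammer_inf (fps_X ^ m) (fps_X ^ 7) :: real fps"
  let ?D = "?Q 2 * (?Q 3 * (?Q 4 * ?Q 5))"
  let ?E = "(1 - fps_X ^ 2) * (1 - fps_X ^ 3) * (1 - fps_X ^ 5) :: real fps"
  have Q0: "fps_nth (?Q m) 0 = 1" if "m > 0" for m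
    using that by (intro has_prod_qpochhammer_inf_fps) auto
  then have inv: "?Q m * inverse (?Q m) = 1" if "m > 0" for m
    using that by (intro inverse_mult_eq_1') simp
  have "fps_nth ?D 0 \<noteq> 0" by (simp add: Q0)
  then have D: "?D * inverse ?D = 1" and "truncated_series k = (-1) ^ k * inverse ?D * pent_tail k"
    by (auto simp: truncated_series_def qpochhammers_inf_def pent_tail_def fps_divide_unit
        intro!: inverse_mult_eq_1')
  then have T: "truncated_series k = (-1) ^ k * pent_tail k * inverse ?D"
    by (simp only: mult_ac)
  have "?Q 2 = (1 - fps_X ^ 2) * ?Q 9" "?Q 3 = (1 - fps_X ^ 3) * ?Q 10" "?Q 5 = (1 - fps_X ^ 5) * ?Q 12"
    using qpochhammer_inf_fps_shift[of 2 7] qpochhammer_inf_fps_shift[of 3 7] qpochhammer_inf_fps_shift[of 5 7]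
    by auto
  then have "?D * (fps235 * cofactor)
      = (?E * fps235) * (?Q 9 * inverse (?Q 9)) * (?Q 10 * inverse (?Q 10))
          * (?Q 12 * inverse (?Q 12)) * (?Q 4 * inverse (?Q 4))"
    unfolding cofactor_def by (simp only: mult_ac)
  also have "\<dots> = fps_const 60"
    by (simp only: inv fps235_inverse) simp
  finally have *: "?D * (fps235 * cofactor) = fps_const 60" .
  have "fps_const 60 * truncated_series k
      = (-1) ^ k * pent_tail k * (fps235 * cofactor) * (?D * inverse ?D)"
    unfolding T *[symmetric] by (simp only: mult_ac)
  then show ?thesis
    unfolding D by (simp only: mult_1_right mult.assoc)
qed

theorem corollary2p3:
  fixes k n :: nat
  assumes "k > 1"
  shows "(n < k * (3 * k + 1) div 2 \<or> n = k * (3 * k + 1) div 2 + 1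
            \<longrightarrow> fps_nth (truncated_series k) n = 0) \<and>
         (n = k * (3 * k + 1) div 2 \<or> n \<ge> k * (3 * k + 1) div 2 + 2
            \<longrightarrow> fps_nth (truncated_series k) n > 0)"
proof -
  define U where "U = (-1) ^ k * pent_tail k * fps235"
  have U_less: "fps_nth U i = 0" if "i < pentagonal k" for i
    using fps_nth_pent_tail_mult_eq_0[OF that, of "(-1) ^ k * fps235"] by (simp add: U_def mult_ac)
  have U_add: "fps_nth U (pentagonal k + m) = real_of_int (tail_coeff (int k) (int m))" for m
    unfolding U_def by (rule fps_nth_pent_tail_fps235)
  have pos: "tail_coeff (int k) (int m) > 0 \<or> k = 2 \<and> (m = 13 \<or> m = 16) \<and> tail_coeff (int k) (int m) = 0"
    if "m \<noteq> 1" for m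
    using tail_coeff_pos[of "int k" "int m"] that assms by auto
  have U1: "fps_nth U (pentagonal k + 1) = 0"
    using tail_coeff_one[of "int k"] assms by (simp add: U_add del: of_nat_add add_Suc_right One_nat_def)
  have U_nonneg: "fps_nth U i \<ge> 0" for i
  proof (cases "i < pentagonal k")
    case False
    then obtain m where i: "i = pentagonal k + m" by (metis le_Suc_ex not_less)
    show ?thesis
    proof (cases "m = 1")
      case True
      with U1 i show ?thesis by simp
    next
      case False
      with pos[of m] show ?thesis unfolding i U_add by auto
    qed
  qed (simp add: U_less)
  have eq: "60 * fps_nth (truncated_series k) n = (\<Sum>i=0..n. fps_nth U i * fps_nth cofactor (n - i))"
    using truncated_series_eq[of k] unfolding U_def[symmetric]
    by (metis fps_mult_left_const_nth fps_mult_nth)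
  \<comment> \<open>All summands are nonnegative, so each alone is a lower bound.\<close>
  have term_le: "fps_nth U i * fps_nth cofactor (n - i) \<le> 60 * fps_nth (truncated_series k) n"
    if "i \<le> n" for i
    unfolding eq by (rule member_le_sum) (use that U_nonneg cofactor_nonneg in auto)
  show ?thesis
  proof (intro conjI impI)
    assume "n < pentagonal k \<or> n = pentagonal k + 1"
    then have "fps_nth U i * fps_nth cofactor (n - i) = 0" if i: "i \<le> n" for i
    proof
      assume "n = pentagonal k + 1"
      with i consider "i < pentagonal k" | "n - i = 1" | "i = pentagonal k + 1"
        by linarith
      then show ?thesis
        using U_less U1 fps_nth_cofactor_1 by cases auto
    qed (use i U_less in auto)
    then have "60 * fps_nth (truncated_series k) n = 0"
      unfolding eq by (intro sum.neutral) simp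
    then show "fps_nth (truncated_series k) n = 0" by simp
  next
    assume "n = pentagonal k \<or> pentagonal k + 2 \<le> n"
    then obtain m where n: "n = pentagonal k + m" and m: "m \<noteq> 1"
      by (intro that[of "n - pentagonal k"]) auto
    show "fps_nth (truncated_series k) n > 0"
    proof (cases "tail_coeff (int k) (int m) > 0")
      case True
      then have "0 < fps_nth U n * fps_nth cofactor (n - n)"
        unfolding n U_add by (simp add: fps_nth_cofactor_0)
      also have "\<dots> \<le> 60 * fps_nth (truncated_series k) n"
        by (rule term_le) simp
      finally show ?thesis by simp
    next
      case False
      with pos[OF m] have "k = 2" "m = 13 \<or> m = 16" by auto
      \<comment> \<open>The offsets 9 and 12 are not exceptional, so the \<open>q^4\<close> term of
        \<open>cofactor\<close> fills both gaps.\<close>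
      with pos[of "m - 4"] have "tail_coeff (int k) (int (m - 4)) > 0" "m \<ge> 4" by auto
      then have "0 < fps_nth U (pentagonal k + (m - 4)) * fps_nth cofactor 4"
        unfolding U_add using fps_nth_cofactor_4 by simp
      also have "\<dots> \<le> 60 * fps_nth (truncated_series k) n"
      proof -
        have "n - (pentagonal k + (m - 4)) = 4"
          unfolding n using \<open>m \<ge> 4\<close> by linarith
        then show ?thesis
          using term_le[of "pentagonal k + (m - 4)"] n by simp
      qed
      finally show ?thesis by simp
    qed
  qed
qed

end
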